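(* Let $G$ be an abelian group, let $R$ be a $G$-graded commutative ring with nonzero unity, and let $M$ be a $G$-graded $R$-module such that $Zd(R)=Zd(M)$. Let $\phi_1: GI(R)\to GI(R)\cup\{\emptyset\}$ and $\phi_2: GI(R(+)M)\to GI(R(+)M)\cup\{\emptyset\}$ be two functions such that $\phi_2(P(+)M)=\phi_1(P)(+)M$ for a proper graded ideal $P$ of $R$. If $P(+)M$ is a graded $\phi_2$-$r$-ideal of $R(+)M$, then $P$ is a graded $\phi_1$-$r$-ideal of $R$.
   Context: $R=\bigoplus_{g\in G}R_g$ with additive subgroups $R_g$ satisfying $R_gR_h\subseteq R_{gh}$; $h(R)=\bigcup_{g\in G}R_g$. An ideal $P$ is graded if $P=\bigoplus_{g\in G}(P\cap R_g)$; for a graded ring $A$, $GI(A)$ is the set of all graded ideals of $A$. An $R$-module $M$ is $G$-graded if $M=\bigoplus_{g\in G}M_g$ with additive subgroups $M_g$ and $R_gM_h\subseteq M_{gh}$. The idealization $R(+)M=\{(r,m): r\in R, m\in M\}$ is the commutative ring with componentwise addition and multiplication $(x,m_1)(y,m_2)=(xy,xm_2+ym_1)$; it is $G$-graded by $(R(+)M)_g=R_g(+)M_g$, the set of pairs with $r\in R_g$, $m\in M_g$. For $P\subseteq R$, $P(+)M=\{(p,m):p\in P,m\in M\}$ (empty if $P=\emptyset$). $Ann(x)$ denotes the annihilator $\{a: ax=0\}$ of $x$ in the ring under consideration. $Zd(R)$ is the set of zero divisors of $R$, i.e. the elements $a$ with $Ann(a)\neq\{0\}$ (so $0\in Zd(R)$),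 and $Zd(M)=\{a\in R: am=0\text{ for some }0\neq m\in M\}$. For a graded ring $A$ and $\phi:GI(A)\to GI(A)\cup\{\emptyset\}$, a proper graded ideal $P$ of $A$ is a graded $\phi$-$r$-ideal if whenever $x,y\in h(A)$ satisfy $xy\in P-\phi(P)$ (set difference) and $Ann(x)=\{0\}$, then $y\in P$. Standing convention: $\phi(P)\subseteq P$ for every graded ideal $P$ and every such function $\phi$. *)

theory Defs
  imports "HOL-Algebra.Module" "HOL-Algebra.Ideal" "HOL-Algebra.Free_Abelian_Groups"
begin

(* Every element of S is the sum of exactly one finitely supported family f with f i in H i,
   and every such sum lies in S.  Families are extensional outside I, so that uniqueness is
   meaningful; gfinprod over the additive monoid sums over the support of f in I. *)
definition internal_direct_sum ::
  "('a, 'r) ring_scheme \<Rightarrow> 'g set \<Rightarrow> ('g \<Rightarrow> 'a set) \<Rightarrow> 'a set \<Rightarrow> bool"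
  where "internal_direct_sum A I H S \<longleftrightarrow>
    (\<forall>i\<in>I. additive_subgroup (H i) A) \<and>
    bij_betw (\<lambda>f. gfinprod (add_monoid A) f I)
      {f \<in> (\<Pi>\<^sub>E i\<in>I. H i). finite {i \<in> I. f i \<noteq> \<zero>\<^bsub>A\<^esub>}} S"

locale graded_ring = G: group G + R: cring R
  for G :: "('g, 'c) monoid_scheme" and R :: "('a, 'r) ring_scheme" +
  fixes Rg :: "'g \<Rightarrow> 'a set"
  assumes ring_direct_sum: "internal_direct_sum R (carrier G) Rg (carrier R)"
    and ring_mult_closed: "\<And>g h x y. \<lbrakk>g \<in> carrier G; h \<in> carrier G; x \<in> Rg g; y \<in> Rg h\<rbrakk>
      \<Longrightarrow> x \<otimes>\<^bsub>R\<^esub> y \<in> Rg (g \<otimes>\<^bsub>G\<^esub> h)"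

locale graded_module = graded_ring G R Rg + M: module R M
  for G :: "('g, 'c) monoid_scheme" and R :: "('a, 'r) ring_scheme" and Rg :: "'g \<Rightarrow> 'a set"
    and M :: "('a, 'b, 'm) module_scheme" +
  fixes Mg :: "'g \<Rightarrow> 'b set"
  assumes module_direct_sum: "internal_direct_sum M (carrier G) Mg (carrier M)"
    and module_smult_closed: "\<And>g h x m. \<lbrakk>g \<in> carrier G; h \<in> carrier G; x \<in> Rg g; m \<in> Mg h\<rbrakk>
      \<Longrightarrow> x \<odot>\<^bsub>M\<^esub> m \<in> Mg (g \<otimes>\<^bsub>G\<^esub> h)"

definition homogeneous :: "('g, 'c) monoid_scheme \<Rightarrow> ('g \<Rightarrow> 'a set) \<Rightarrow> 'a set"
  where "homogeneous G Ag = (\<Union>g\<in>carrier G. Ag g)"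

definition graded_ideals ::
  "('g, 'c) monoid_scheme \<Rightarrow> ('a, 'r) ring_scheme \<Rightarrow> ('g \<Rightarrow> 'a set) \<Rightarrow> 'a set set"
  where "graded_ideals G A Ag =
    {P. ideal P A \<and> internal_direct_sum A (carrier G) (\<lambda>g. P \<inter> Ag g) P}"

definition Ann :: "('a, 'r) ring_scheme \<Rightarrow> 'a \<Rightarrow> 'a set"
  where "Ann A x = {a \<in> carrier A. a \<otimes>\<^bsub>A\<^esub> x = \<zero>\<^bsub>A\<^esub>}"

definition Zd_ring :: "('a, 'r) ring_scheme \<Rightarrow> 'a set"
  where "Zd_ring R = {a \<in> carrier R. Ann R a \<noteq> {\<zero>\<^bsub>R\<^esub>}}"

definition Zd_module :: "('a, 'r) ring_scheme \<Rightarrow> ('a, 'b, 'm) module_scheme \<Rightarrow> 'a set"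
  where "Zd_module R M =
    {a \<in> carrier R. \<exists>m \<in> carrier M. m \<noteq> \<zero>\<^bsub>M\<^esub> \<and> a \<odot>\<^bsub>M\<^esub> m = \<zero>\<^bsub>M\<^esub>}"

definition idealization ::
  "('a, 'r) ring_scheme \<Rightarrow> ('a, 'b, 'm) module_scheme \<Rightarrow> ('a \<times> 'b) ring"
  where "idealization R M =
    \<lparr>carrier = carrier R \<times> carrier M,
     monoid.mult = (\<lambda>(x, m) (y, n). (x \<otimes>\<^bsub>R\<^esub> y, (x \<odot>\<^bsub>M\<^esub> n) \<oplus>\<^bsub>M\<^esub> (y \<odot>\<^bsub>M\<^esub> m))),
     monoid.one = (\<one>\<^bsub>R\<^esub>, \<zero>\<^bsub>M\<^esub>),
     ring.zero = (\<zero>\<^bsub>R\<^esub>, \<zero>\<^bsub>M\<^esub>),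
     ring.add = (\<lambda>(x, m) (y, n). (x \<oplus>\<^bsub>R\<^esub> y, m \<oplus>\<^bsub>M\<^esub> n))\<rparr>"

definition idealization_grading :: "('g \<Rightarrow> 'a set) \<Rightarrow> ('g \<Rightarrow> 'b set) \<Rightarrow> 'g \<Rightarrow> ('a \<times> 'b) set"
  where "idealization_grading Rg Mg g = Rg g \<times> Mg g"

definition idealization_set :: "'a set \<Rightarrow> ('a, 'b, 'm) module_scheme \<Rightarrow> ('a \<times> 'b) set"
  where "idealization_set P M = P \<times> carrier M"

(* Functions GI(A) -> GI(A) \<union> {\<emptyset>} subject to the standing convention phi(P) \<subseteq> P.
   Values of phi on sets that are not graded ideals are irrelevant. *)
definition graded_ideal_maps ::
  "('g, 'c) monoid_scheme \<Rightarrow> ('a, 'r) ring_scheme \<Rightarrow> ('g \<Rightarrow> 'a set) \<Rightarrow> ('a set \<Rightarrow> 'a set) set"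
  where "graded_ideal_maps G A Ag =
    {\<phi> \<in> graded_ideals G A Ag \<rightarrow> graded_ideals G A Ag \<union> {{}}.
      \<forall>P \<in> graded_ideals G A Ag. \<phi> P \<subseteq> P}"

definition graded_phi_r_ideal ::
  "('g, 'c) monoid_scheme \<Rightarrow> ('a, 'r) ring_scheme \<Rightarrow> ('g \<Rightarrow> 'a set) \<Rightarrow> ('a set \<Rightarrow> 'a set) \<Rightarrow>
    'a set \<Rightarrow> bool"
  where "graded_phi_r_ideal G A Ag \<phi> P \<longleftrightarrow>
    P \<in> graded_ideals G A Ag \<and> P \<noteq> carrier A \<and>
    (\<forall>x \<in> homogeneous G Ag. \<forall>y \<in> homogeneous G Ag.
      x \<otimes>\<^bsub>A\<^esub> y \<in> P - \<phi> P \<and> Ann A x = {\<zero>\<^bsub>A\<^esub>} \<longrightarrow> y \<in> P)"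

end

theory Submission
  imports Defs
begin

text \<open>The map x -> (x, 0) embeds R multiplicatively in R(+)M, so the defining implication for
  P can be tested on images. Homogeneous elements stay homogeneous
  (\<open>homogeneous_idealization\<close>), and for y in R, (y, 0) lies in P(+)M exactly when y
  lies in P, and likewise for the values of the two functions. What could fail is that (x, 0)
  acquires annihilators from M: since (a, m)(x, 0) = (ax, xm), its annihilator vanishes only if x is
  regular on both R and M. The equality Zd(R) = Zd(M) turns the first regularity into the second,
  which is what \<open>Ann_idealization_eq_zero\<close> needs.\<close>

lemma Ann_idealization_eq_zero:
  assumes "module R M" and x: "x \<in> carrier R" and ann: "Ann R x = {\<zero>\<^bsub>R\<^esub>}"
    and nz: "x \<notin> Zd_module R M"
  shows "Ann (idealization R M) (x, \<zero>\<^bsub>M\<^esub>) = {\<zero>\<^bsub>idealization R M\<^esub>}"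
proof -
  interpret module R M by fact
  \<comment> \<open>The two equations are the coordinates of (a, m)(x, 0) = 0. As a acts on zero
    trivially, they decouple: \<open>ann\<close> settles a and \<open>nz\<close> settles m.\<close>
  have iff: "a \<otimes>\<^bsub>R\<^esub> x = \<zero>\<^bsub>R\<^esub> \<and> a \<odot>\<^bsub>M\<^esub> \<zero>\<^bsub>M\<^esub> \<oplus>\<^bsub>M\<^esub> x \<odot>\<^bsub>M\<^esub> m = \<zero>\<^bsub>M\<^esub>
      \<longleftrightarrow> a = \<zero>\<^bsub>R\<^esub> \<and> m = \<zero>\<^bsub>M\<^esub>"
    if am: "a \<in> carrier R" "m \<in> carrier M" for a m
  proof -
    have "a \<otimes>\<^bsub>R\<^esub> x = \<zero>\<^bsub>R\<^esub> \<longleftrightarrow> a = \<zero>\<^bsub>R\<^esub>" using am(1) ann unfolding Ann_def by blast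
    moreover have "x \<odot>\<^bsub>M\<^esub> m = \<zero>\<^bsub>M\<^esub> \<longleftrightarrow> m = \<zero>\<^bsub>M\<^esub>"
      using nz x am smult_r_null unfolding Zd_module_def by blast
    ultimately show ?thesis using am x by simp
  qed
  have "(a, m) \<in> Ann (idealization R M) (x, \<zero>\<^bsub>M\<^esub>) \<longleftrightarrow> a = \<zero>\<^bsub>R\<^esub> \<and> m = \<zero>\<^bsub>M\<^esub>" for a m
  proof -
    have "(a, m) \<in> Ann (idealization R M) (x, \<zero>\<^bsub>M\<^esub>) \<longleftrightarrow>
        (a \<in> carrier R \<and> m \<in> carrier M) \<and>
        (a \<otimes>\<^bsub>R\<^esub> x = \<zero>\<^bsub>R\<^esub> \<and> a \<odot>\<^bsub>M\<^esub> \<zero>\<^bsub>M\<^esub> \<oplus>\<^bsub>M\<^esub> x \<odot>\<^bsub>M\<^esub> m = \<zero>\<^bsub>M\<^esub>)"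
      unfolding Ann_def idealization_def mem_Collect_eq partial_object.simps monoid.simps
        ring.simps prod.case mem_Times_iff fst_conv snd_conv prod.inject ..
    then show ?thesis using iff[of a m] R.zero_closed M.zero_closed by blast
  qed
  moreover have "\<zero>\<^bsub>idealization R M\<^esub> = (\<zero>\<^bsub>R\<^esub>, \<zero>\<^bsub>M\<^esub>)"
    by (simp add: idealization_def)
  ultimately show ?thesis by auto
qed

text \<open>Zero belongs to every component of M, so the degree of x also serves as the degree of
  the pair.\<close>

lemma homogeneous_idealization:
  assumes "internal_direct_sum M (carrier G) Mg S" and "x \<in> homogeneous G Rg"
  shows "(x, \<zero>\<^bsub>M\<^esub>) \<in> homogeneous G (idealization_grading Rg Mg)"
proof -
  obtain g where g: "g \<in> carrier G" "x \<in> Rg g"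
    using assms(2) by (auto simp: homogeneous_def)
  then have "\<zero>\<^bsub>M\<^esub> \<in> Mg g"
    using assms(1) additive_subgroup.zero_closed
    unfolding internal_direct_sum_def by blast
  with g show ?thesis by (auto simp: homogeneous_def idealization_grading_def)
qed

theorem theorem2p22:
  fixes G :: "('g, 'c) monoid_scheme"
    and R :: "('a, 'r) ring_scheme"
    and Rg :: "'g \<Rightarrow> 'a set"
    and M :: "('a, 'b, 'm) module_scheme"
    and Mg :: "'g \<Rightarrow> 'b set"
    and \<phi>\<^sub>1 :: "'a set \<Rightarrow> 'a set"
    and \<phi>\<^sub>2 :: "('a \<times> 'b) set \<Rightarrow> ('a \<times> 'b) set"
    and P :: "'a set"
  assumes "comm_group G"
    and "graded_ring G R Rg"
    and "\<one>\<^bsub>R\<^esub> \<noteq> \<zero>\<^bsub>R\<^esub>"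
    and "graded_module G R Rg M Mg"
    and "Zd_ring R = Zd_module R M"
    and "\<phi>\<^sub>1 \<in> graded_ideal_maps G R Rg"
    and "\<phi>\<^sub>2 \<in> graded_ideal_maps G (idealization R M) (idealization_grading Rg Mg)"
    and "P \<in> graded_ideals G R Rg" and "P \<noteq> carrier R"
    and "\<phi>\<^sub>2 (idealization_set P M) = idealization_set (\<phi>\<^sub>1 P) M"
    and "graded_phi_r_ideal G (idealization R M) (idealization_grading Rg Mg) \<phi>\<^sub>2
           (idealization_set P M)"
  shows "graded_phi_r_ideal G R Rg \<phi>\<^sub>1 P"
proof -
  interpret graded_module G R Rg M Mg by fact
  have carr: "x \<in> carrier R" if "x \<in> homogeneous G Rg" for x
    using that ring_direct_sum
    by (meson UN_E additive_subgroup.a_Hcarr homogeneous_def[THEN equalityD1, THEN subsetD]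
        internal_direct_sum_def)
  have "y \<in> P" if h: "x \<in> homogeneous G Rg" "y \<in> homogeneous G Rg"
    and xy: "x \<otimes>\<^bsub>R\<^esub> y \<in> P - \<phi>\<^sub>1 P" and ann: "Ann R x = {\<zero>\<^bsub>R\<^esub>}" for x y
  proof -
    \<comment> \<open>Regularity of x on R passes to M through Zd(R) = Zd(M).\<close>
    have "x \<notin> Zd_module R M"
      using ann assms(5) by (auto simp: Zd_ring_def)
    then have "Ann (idealization R M) (x, \<zero>\<^bsub>M\<^esub>) = {\<zero>\<^bsub>idealization R M\<^esub>}"
      using Ann_idealization_eq_zero[OF M.module_axioms] carr h ann by blast
    \<comment> \<open>The product is (xy, 0). The compatibility of \<open>\<phi>\<^sub>1\<close> and
      \<open>\<phi>\<^sub>2\<close> makes the difference equal to that of P and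
      \<open>\<phi>\<^sub>1 P\<close> in the first coordinate; this also covers an empty
      \<open>\<phi>\<^sub>1 P\<close>.\<close>
    moreover have "(x, \<zero>\<^bsub>M\<^esub>) \<otimes>\<^bsub>idealization R M\<^esub> (y, \<zero>\<^bsub>M\<^esub>)
        \<in> idealization_set P M - \<phi>\<^sub>2 (idealization_set P M)"
      unfolding assms(10) using xy carr[OF h(1)] carr[OF h(2)]
      by (simp add: idealization_def idealization_set_def)
    ultimately have "(y, \<zero>\<^bsub>M\<^esub>) \<in> idealization_set P M"
      using assms(11)[unfolded graded_phi_r_ideal_def, THEN conjunct2, THEN conjunct2,
          rule_format, OF homogeneous_idealization[OF module_direct_sum h(1)]
          homogeneous_idealization[OF module_direct_sum h(2)]]
      by simp
    then show ?thesis by (simp add: idealization_set_def)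
  qed
  then show ?thesis using assms(8,9) by (auto simp: graded_phi_r_ideal_def)
qed

end
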